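(* Suppose that (A1) for all $b,b'\in\mathcal B$, $\phi(b,t)-\phi(b',t)$ is single-crossing in $t$ and $v(b,t)-v(b',t)$ is monotonic in $t$; (A2) for all $a,a'\in\Delta(\mathcal B)$, $\phi(a,t)-\phi(a',t)$ is single-crossing in $t$; and $\{b^*\}=\operatorname{argmax}_{b\in\mathcal B}v(b,\bar t)$, where $b^*=\{1,\dots,n\}$ is the grand bundle. If $Q(b^* )\ge\max_{b\ne b^*}Q(b)$, then $\{\emptyset,b^*\}$ is the minimal optimal menu of the monopolist's problem.
   Context: Setup. There are $n\ge 1$ goods; $\mathcal B=2^{\{1,\dots,n\}}$ is the set of (deterministic) bundles and $\Delta(\mathcal B)$ is the set of probability distributions on $\mathcal B$ (stochastic bundles); a bundle $b$ is identified with the point mass at $b$. Types $t$ lie in $T=[\underline t,\bar t]\subseteq\mathbb R$, $\underline t<\bar t$, and are distributed according to $F$ with a continuous, positive density $f$. The value function $v:\Delta(\mathcal B)\times T\to\mathbb R$ is continuously differentiable in $t$, with $v(\emptyset,t)=0$ for all $t$ and $v(a,t)=\mathbb E_{b\sim a}[v(b,t)]$. The virtual value function is $\phi(b,t)=v(b,t)-\frac{1-F(t)}{f(t)}v_t(b,t)$, $v_t=\partial v/\partial t$, extended by $\phi(a,t)=\mathbb E_{b\sim a}[\phi(b,t)]$ for $a\in\Delta(\mathcal B)$; note $\phi(b,\bar t)=v(b,\bar t)$. Standing assumptions: for $b\ne b'$ in $\mathcal B$ there is $t\in T$ with $\phi(b,t)\neq\phi(b',t)$; $\max_{b\neq\emptyset}\phi(b,\underline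 t)<0=\phi(\emptyset,\underline t)$; and $v(b,\bar t)>0$ for all $b\ne\emptyset$. Sold-alone quantity. For $b\ne\emptyset$, $Q(b)=1-F(t_b)\in[0,1]$ where $t_b\in T$ satisfies $\phi(b,t_b)=0$; it is assumed that this zero $t_b$ is unique for each $b\neq\emptyset$, so that $Q$ is well defined. Convention: $Q(\emptyset)=0$. Terminology. A function $g:T\to\mathbb R$ is single-crossing in $t$ if $\operatorname{sign}[g(t)]\in\{-1,0,1\}$ is a monotonic function of $t$ (either weakly increasing or weakly decreasing). "Monotonic" means weakly increasing or weakly decreasing on $T$. Monopolist's problem. A mechanism is a measurable map $(a,p):T\to\Delta(\mathcal B)\times\mathbb R$. It is IC if $v(a(t),t)-p(t)\ge v(a(t'),t)-p(t')$ for all $t,t'\in T$, and IR if $v(a(t),t)-p(t)\ge 0$ for all $t\in T$. The monopolist maximizes $\mathbb E[p(t)]$ over IC and IR mechanisms. A menu $B\subseteq\mathcal B$ is optimal if there is an optimal mechanism $(a,p)$ with $a(t)\in B$ for all $t$; an optimal menu $B$ is a minimal optimal menu if no $B'\subsetneq B$ is optimal. (Under (A1) and (A2) the minimal optimal menu is unique.) *)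

theory Defs
  imports "HOL-Probability.Probability"
begin

definition monotonic_on :: "real set \<Rightarrow> (real \<Rightarrow> real) \<Rightarrow> bool" where
  "monotonic_on T g \<longleftrightarrow> mono_on T g \<or> antimono_on T g"

definition single_crossing_on :: "real set \<Rightarrow> (real \<Rightarrow> real) \<Rightarrow> bool" where
  "single_crossing_on T g \<longleftrightarrow> monotonic_on T (\<lambda>t. sgn (g t))"

definition bundles :: "nat \<Rightarrow> nat set set" where
  "bundles n = Pow {1..n}"

definition stoch_bundles :: "nat \<Rightarrow> nat set pmf set" where
  "stoch_bundles n = {a. set_pmf a \<subseteq> bundles n}"

definition stoch_ext :: "(nat set \<Rightarrow> real \<Rightarrow> real) \<Rightarrow> nat set pmf \<Rightarrow> real \<Rightarrow> real" where
  "stoch_ext g a t = measure_pmf.expectation a (\<lambda>b. g b t)"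

text \<open>The law of the type, as a measure whose underlying space is the type interval itself, so
  that values of functions outside the interval are irrelevant.\<close>

definition type_law :: "real \<Rightarrow> real \<Rightarrow> (real \<Rightarrow> real) \<Rightarrow> real measure" where
  "type_law tlo thi f = density (restrict_space lborel {tlo..thi}) (\<lambda>t. ennreal (f t))"

text \<open>The value function is given on deterministic bundles; its values at stochastic bundles are
  those of \<^const>\<open>stoch_ext\<close>. The parameter \<open>v_t\<close> is the partial derivative of \<open>v\<close> in the type
  (one-sided at the end points), which is unique on the type interval.\<close>

locale screening =
  fixes n :: nat and tlo thi :: real and f :: "real \<Rightarrow> real"
    and v v_t :: "nat set \<Rightarrow> real \<Rightarrow> real"
  assumes goods: "n \<ge> 1"
    and types: "tlo < thi"
    and density_cont: "continuous_on {tlo..thi} f"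
    and density_pos: "\<And>t. t \<in> {tlo..thi} \<Longrightarrow> f t > 0"
    and density_prob: "prob_space (type_law tlo thi f)"
    and v_deriv: "\<And>b t. b \<in> bundles n \<Longrightarrow> t \<in> {tlo..thi} \<Longrightarrow>
          (v b has_real_derivative v_t b t) (at t within {tlo..thi})"
    and v_deriv_cont: "\<And>b. b \<in> bundles n \<Longrightarrow> continuous_on {tlo..thi} (v_t b)"
    and v_empty: "\<And>t. t \<in> {tlo..thi} \<Longrightarrow> v {} t = 0"
begin

definition F :: "real \<Rightarrow> real" where
  "F t = measure (type_law tlo thi f) {tlo..t}"

definition phi :: "nat set \<Rightarrow> real \<Rightarrow> real" where
  "phi b t = v b t - (1 - F t) / f t * v_t b t"

end

locale monopolist = screening +
  assumes phi_distinct: "\<And>b b'. b \<in> bundles n \<Longrightarrow> b' \<in> bundles n \<Longrightarrow> b \<noteq> b' \<Longrightarrow>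
          \<exists>t\<in>{tlo..thi}. phi b t \<noteq> phi b' t"
    and phi_bottom: "Max ((\<lambda>b. phi b tlo) ` (bundles n - {{}})) < 0" "phi {} tlo = 0"
    and v_top_pos: "\<And>b. b \<in> bundles n \<Longrightarrow> b \<noteq> {} \<Longrightarrow> v b thi > 0"
    and phi_zero_unique: "\<And>b. b \<in> bundles n \<Longrightarrow> b \<noteq> {} \<Longrightarrow>
          \<exists>!t. t \<in> {tlo..thi} \<and> phi b t = 0"
begin

definition Q :: "nat set \<Rightarrow> real" where
  "Q b = (if b = {} then 0 else 1 - F (THE t. t \<in> {tlo..thi} \<and> phi b t = 0))"

definition A1 :: bool where
  "A1 \<longleftrightarrow> (\<forall>b\<in>bundles n. \<forall>b'\<in>bundles n.
     single_crossing_on {tlo..thi} (\<lambda>t. phi b t - phi b' t) \<and>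
     monotonic_on {tlo..thi} (\<lambda>t. v b t - v b' t))"

definition A2 :: bool where
  "A2 \<longleftrightarrow> (\<forall>a\<in>stoch_bundles n. \<forall>a'\<in>stoch_bundles n.
     single_crossing_on {tlo..thi} (\<lambda>t. stoch_ext phi a t - stoch_ext phi a' t))"

text \<open>Measurability of the allocation is with respect to the Borel structure of the finite-dimensional
  simplex of stochastic bundles, i.e. measurability of each probability.\<close>

definition mechanism :: "(real \<Rightarrow> nat set pmf) \<Rightarrow> (real \<Rightarrow> real) \<Rightarrow> bool" where
  "mechanism a p \<longleftrightarrow>
     (\<forall>t\<in>{tlo..thi}. a t \<in> stoch_bundles n) \<and>
     (\<forall>b\<in>bundles n. (\<lambda>t. pmf (a t) b) \<in> borel_measurable (restrict_space borel {tlo..thi})) \<and>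
     p \<in> borel_measurable (restrict_space borel {tlo..thi})"

definition IC :: "(real \<Rightarrow> nat set pmf) \<Rightarrow> (real \<Rightarrow> real) \<Rightarrow> bool" where
  "IC a p \<longleftrightarrow> (\<forall>t\<in>{tlo..thi}. \<forall>t'\<in>{tlo..thi}.
     stoch_ext v (a t) t - p t \<ge> stoch_ext v (a t') t - p t')"

definition IR :: "(real \<Rightarrow> nat set pmf) \<Rightarrow> (real \<Rightarrow> real) \<Rightarrow> bool" where
  "IR a p \<longleftrightarrow> (\<forall>t\<in>{tlo..thi}. stoch_ext v (a t) t - p t \<ge> 0)"

definition feasible :: "(real \<Rightarrow> nat set pmf) \<Rightarrow> (real \<Rightarrow> real) \<Rightarrow> bool" where
  "feasible a p \<longleftrightarrow> mechanism a p \<and> IC a p \<and> IR a p"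

text \<open>The payments of a feasible mechanism are bounded (IR and boundedness of \<open>v\<close> bound them from
  above, IC bounds their differences), so they are integrable.\<close>

definition revenue :: "(real \<Rightarrow> real) \<Rightarrow> real" where
  "revenue p = integral\<^sup>L (type_law tlo thi f) p"

definition optimal_mechanism :: "(real \<Rightarrow> nat set pmf) \<Rightarrow> (real \<Rightarrow> real) \<Rightarrow> bool" where
  "optimal_mechanism a p \<longleftrightarrow> feasible a p \<and> (\<forall>a' p'. feasible a' p' \<longrightarrow> revenue p' \<le> revenue p)"

definition optimal_menu :: "nat set set \<Rightarrow> bool" where
  "optimal_menu B \<longleftrightarrow> B \<subseteq> bundles n \<and>
     (\<exists>a p. optimal_mechanism a p \<and> (\<forall>t\<in>{tlo..thi}. a t \<in> return_pmf ` B))"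

definition minimal_optimal_menu :: "nat set set \<Rightarrow> bool" where
  "minimal_optimal_menu B \<longleftrightarrow> optimal_menu B \<and> (\<forall>B'. B' \<subset> B \<longrightarrow> \<not> optimal_menu B')"

end

end

theory Submission
  imports Defs
begin

text \<open>
  Let \<open>t\<^sup>*\<close> be the zero of the virtual value of the grand bundle. By \<open>Q\<close>-dominance the zeros of all other
  virtual values lie above \<open>t\<^sup>*\<close>, so below \<open>t\<^sup>*\<close> the empty bundle has the largest virtual value.
  The difference between the virtual values of the grand bundle and of another bundle is nonnegative
  at \<open>t\<^sup>*\<close> and positive at the top type, hence by single crossing nonnegative in between. So selling the
  grand bundle at the price \<open>v(b\<^sup>*, t\<^sup>*)\<close> maximizes the virtual surplus type by type, which bounds
  the revenue of every feasible mechanism. Strict inequalities below \<open>t\<^sup>*\<close> and near the top type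
  show that every optimal menu contains the empty and the grand bundle.
\<close>

section \<open>Inequalities for integrals over a compact interval\<close>

text \<open>Integrating the hypothesis over \<open>t\<close> and dividing by \<open>h\<close> telescopes the right-hand side into two
  local averages of \<open>K\<close>, so no differentiability of \<open>K\<close> is needed.\<close>

lemma integral_le_increment:
  fixes K g :: "real \<Rightarrow> real"
  assumes ab: "a < b" and K: "continuous_on {a..b} K" and g: "g integrable_on {a..b}"
    and inc: "\<And>e. e > 0 \<Longrightarrow> \<forall>\<^sub>F h in at_right 0. \<forall>t. a \<le> t \<and> t + h \<le> b \<longrightarrow>
                h * (g t - e) \<le> K (t + h) - K t"
  shows "integral {a..b} g \<le> K b - K a"
proof -
  define P where "P x = integral {a..x} K" for x
  define I where "I x = integral {a..x} g" for x
  have P_diff: "integral {x..y} K = P y - P x" if "a \<le> x" "x \<le> y" "y \<le> b" for x y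
    using Henstock_Kurzweil_Integration.integral_combine[of a x y K] that K
    by (simp add: P_def integrable_continuous_real continuous_on_subset)
  have dP: "(P has_real_derivative K x) (at x within {a..b})" if "x \<in> {a..b}" for x
    unfolding P_def using integral_has_real_derivative[OF K that] .
  \<comment> \<open>The averages of \<open>K\<close> over \<open>{a..a + h}\<close> and over
    \<open>{b - h..b}\<close> tend to the end values, because \<open>P\<close> has one-sided
    derivatives \<open>K a\<close> and \<open>K b\<close> there.\<close>
  have slope_a: "((\<lambda>h. (P (a + h) - P a) / h) \<longlongrightarrow> K a) (at_right 0)"
  proof -
    have "((\<lambda>y. (P y - P a) / (y - a)) \<longlongrightarrow> K a) (at_right a)"
      using dP[of a] ab by (simp add: has_field_derivative_iff at_within_Icc_at_right)
    then show ?thesis by (simp add: filterlim_at_right_to_0[of _ _ a] add.commute)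
  qed
  have slope_b: "((\<lambda>h. (P b - P (b - h)) / h) \<longlongrightarrow> K b) (at_right 0)"
  proof -
    have "((\<lambda>y. (P y - P b) / (y - b)) \<longlongrightarrow> K b) (at_left b)"
      using dP[of b] ab by (simp add: has_field_derivative_iff at_within_Icc_at_left)
    then have "((\<lambda>h. (P (- h) - P b) / (- h - b)) \<longlongrightarrow> K b) (at_right (- b))"
      by (simp add: filterlim_at_left_to_right)
    then have "((\<lambda>h. (P (b - h) - P b) / (- h)) \<longlongrightarrow> K b) (at_right 0)"
      by (simp add: filterlim_at_right_to_0[of _ _ "- b"])
    moreover have "(P (b - h) - P b) / (- h) = (P b - P (b - h)) / h" for h
      by (metis minus_diff_eq minus_divide_right minus_divide_left)
    ultimately show ?thesis by simp
  qed
  \<comment> \<open>The hypothesis can be integrated only up to \<open>b - h\<close>; continuity of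
    the indefinite integral recovers the lost piece as \<open>h\<close> tends to 0.\<close>
  have I_lim: "((\<lambda>h. I (b - h)) \<longlongrightarrow> I b) (at_right 0)"
  proof -
    have "continuous_on {a..b} I"
      unfolding I_def by (rule indefinite_integral_continuous_1[OF g])
    then have "(I \<longlongrightarrow> I b) (at_left b)"
      using ab by (auto simp: continuous_on_def at_within_Icc_at_left dest: bspec[of _ _ b])
    then show ?thesis
      by (simp add: filterlim_at_left_to_right filterlim_at_right_to_0[of _ _ "- b"])
  qed
  have approx: "I b - e * (b - a) \<le> K b - K a" if e: "e > 0" for e
  proof -
    obtain d where d: "d > 0" and dinc: "\<And>t h. a \<le> t \<Longrightarrow> t + h \<le> b \<Longrightarrow> 0 < h \<Longrightarrow> h < d \<Longrightarrow>
                h * (g t - e) \<le> K (t + h) - K t"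
      using inc[OF e] by (auto simp: eventually_at_right_field)
    \<comment> \<open>For a fixed step \<open>h\<close> the pointwise bound is integrated over
      \<open>{a..b - h}\<close>, the range on which \<open>t + h\<close> stays in the
      interval.\<close>
    have step: "I (b - h) - e * (b - h - a) \<le> (P b - P (b - h)) / h - (P (a + h) - P a) / h"
      if h: "0 < h" "h < min d (b - a)" for h
    proof -
      have g': "g integrable_on {a..b - h}"
        by (rule integrable_subinterval_real[OF g]) (use h in auto)
      have K': "continuous_on {a..b - h} K" and K'': "continuous_on {a..b - h} (\<lambda>t. K (t + h))"
        using h by (auto intro!: continuous_on_subset[OF K] continuous_on_compose2[OF K]
            continuous_intros)
      have "integral {a..b - h} (\<lambda>t. g t - e) = I (b - h) - e * (b - h - a)"
        using h g' by (simp add: I_def Henstock_Kurzweil_Integration.integral_diff[OF g' integrable_const_ivl])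
      then have "h * (I (b - h) - e * (b - h - a)) = integral {a..b - h} (\<lambda>t. h * (g t - e))"
        by simp
      also have "\<dots> \<le> integral {a..b - h} (\<lambda>t. K (t + h) - K t)"
      proof (rule integral_le)
        show "(\<lambda>t. h * (g t - e)) integrable_on {a..b - h}"
          by (intro integrable_on_mult_right integrable_diff integrable_const_ivl g')
        show "(\<lambda>t. K (t + h) - K t) integrable_on {a..b - h}"
          by (intro integrable_continuous_real continuous_intros K' K'')
      qed (use h dinc in auto)
      \<comment> \<open>The shift by \<open>h\<close> turns the first integral into one over
        \<open>{a + h..b}\<close>, so everything cancels except two pieces of length
        \<open>h\<close> at the ends.\<close>
      also have "\<dots> = integral {a..b - h} (K \<circ> (+) h) - integral {a..b - h} K"
        using K' K'' by (subst Henstock_Kurzweil_Integration.integral_diff) (auto simp: integrable_continuous_real o_def add.commute)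
      also have "\<dots> = (P b - P (a + h)) - (P (b - h) - P a)"
        using h by (simp only: integral_shift_Icc_real) (simp add: P_diff)
      finally have "I (b - h) - e * (b - h - a) \<le> ((P b - P (a + h)) - (P (b - h) - P a)) / h"
        using h by (simp add: pos_le_divide_eq mult.commute)
      also have "\<dots> = (P b - P (b - h)) / h - (P (a + h) - P a) / h"
        by (simp add: diff_divide_distrib)
      finally show ?thesis .
    qed
    show ?thesis
    proof (rule tendsto_le[OF trivial_limit_at_right_real])
      show "((\<lambda>h. (P b - P (b - h)) / h - (P (a + h) - P a) / h) \<longlongrightarrow> K b - K a) (at_right 0)"
        by (intro tendsto_diff slope_a slope_b)
      have "((\<lambda>h. I (b - h) - e * (b - h - a)) \<longlongrightarrow> I b - e * (b - 0 - a)) (at_right 0)"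
        by (intro tendsto_intros I_lim)
      then show "((\<lambda>h. I (b - h) - e * (b - h - a)) \<longlongrightarrow> I b - e * (b - a)) (at_right 0)"
        by simp
      show "\<forall>\<^sub>F h in at_right 0. I (b - h) - e * (b - h - a) \<le> (P b - P (b - h)) / h - (P (a + h) - P a) / h"
        using d ab by (auto simp: eventually_at_right intro!: exI[of _ "min d (b - a)"] step)
    qed
  qed
  have "I b \<le> K b - K a"
  proof (rule field_le_epsilon)
    fix e :: real assume "e > 0"
    \<comment> \<open>The error in \<open>approx\<close> is proportional to the length of the
      interval, hence the rescaling by \<open>b - a\<close>.\<close>
    then show "I b \<le> K b - K a + e"
      using approx[of "e / (b - a)"] ab by simp
  qed
  then show ?thesis by (simp add: I_def)
qed

text \<open>Uniform continuity as an eventual property of the step \<open>h\<close>, so that it can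
  be combined with other conditions on small \<open>h\<close> by
  \<open>eventually_elim\<close>.\<close>

lemma uniformly_continuous_eventually_at_right:
  fixes g :: "real \<Rightarrow> real"
  assumes g: "continuous_on {a..b} g" and e: "e > 0"
  shows "\<forall>\<^sub>F h in at_right 0. \<forall>s\<in>{a..b}. \<forall>t\<in>{a..b}. \<bar>s - t\<bar> \<le> h \<longrightarrow> \<bar>g s - g t\<bar> \<le> e"
proof -
  have "uniformly_continuous_on {a..b} g"
    using g by (rule compact_uniformly_continuous) simp
  then obtain d where "d > 0" "\<forall>s\<in>{a..b}. \<forall>t\<in>{a..b}. dist t s < d \<longrightarrow> dist (g t) (g s) < e"
    using e unfolding uniformly_continuous_on_def by metis
  then show ?thesis
    by (auto simp: eventually_at_right_field dist_real_def abs_minus_commute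
        intro!: exI[of _ d] less_imp_le)
qed

lemma bounded_measurable_set_integrable:
  fixes g :: "real \<Rightarrow> real"
  assumes "g \<in> borel_measurable (restrict_space borel {a..b})"
    and "\<And>t. t \<in> {a..b} \<Longrightarrow> \<bar>g t\<bar> \<le> M"
  shows "set_integrable lborel {a..b} g"
proof (rule set_integrable_bound[where f = "\<lambda>_. M"])
  show "set_borel_measurable lborel {a..b} g"
    using assms(1) by (simp add: set_borel_measurable_def borel_measurable_restrict_space_iff)
  show "set_integrable lborel {a..b} (\<lambda>_. M)"
    by (intro borel_integrable_atLeastAtMost' continuous_on_const)
qed (use assms(2) in fastforce)

text \<open>If the nonnegative difference had integral 0, it would vanish almost everywhere, but it
  is positive on an open interval of positive length.\<close>

lemma integral_strict_mono_set_integrable: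
  fixes g g' :: "real \<Rightarrow> real"
  assumes g: "set_integrable lborel {a..b} g" and g': "set_integrable lborel {a..b} g'"
    and le: "\<And>t. t \<in> {a..b} \<Longrightarrow> g t \<le> g' t"
    and less: "\<And>t. t \<in> {c<..<d} \<Longrightarrow> g t < g' t" and cd: "c < d" "{c<..<d} \<subseteq> {a..b}"
  shows "integral {a..b} g < integral {a..b} g'"
proof -
  define D where "D t = indicator {a..b} t * (g' t - g t)" for t
  have D: "integrable lborel D"
    using set_integral_diff(1)[OF g' g] by (simp add: set_integrable_def D_def[abs_def])
  have nn: "AE t in lborel. 0 \<le> D t"
    using le by (auto simp: D_def indicator_def)
  have "integral\<^sup>L lborel D \<noteq> 0"
  proof
    assume "integral\<^sup>L lborel D = 0"
    then have "AE t in lborel. D t = 0"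
      using integral_nonneg_eq_0_iff_AE[OF D nn] by simp
    then have "AE t in lborel. t \<notin> {c<..<d}"
      by eventually_elim (use less cd(2) in \<open>force simp: D_def indicator_def\<close>)
    then have "emeasure lborel {c<..<d} = 0"
      by (subst (asm) AE_iff_measurable[of "{c<..<d}"]) auto
    then show False using cd(1) by simp
  qed
  moreover have "integral\<^sup>L lborel D \<ge> 0"
    by (rule integral_nonneg_AE[OF nn])
  moreover have "integral\<^sup>L lborel D = integral {a..b} g' - integral {a..b} g"
    using set_integral_diff(2)[OF g' g] set_borel_integral_eq_integral(2)[OF g]
      set_borel_integral_eq_integral(2)[OF g']
    by (simp add: set_lebesgue_integral_def D_def[abs_def])
  ultimately show ?thesis by simp
qed

section \<open>The type distribution, values and virtual values\<close>

context screening
begin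

lemma finite_bundles: "finite (bundles n)"
  by (simp add: bundles_def)

lemma empty_bundle: "{} \<in> bundles n"
  by (simp add: bundles_def)

lemma v_cont: "b \<in> bundles n \<Longrightarrow> continuous_on {tlo..thi} (v b)"
  by (rule DERIV_continuous_on[OF v_deriv])

text \<open>\<open>v {}\<close> is known to vanish on the type interval, so its derivative within
  that interval is also one of the zero function. It is unique because the interval is
  nondegenerate.\<close>

lemma v_t_empty:
  assumes t: "t \<in> {tlo..thi}"
  shows "v_t {} t = 0"
proof -
  have "((\<lambda>_. 0) has_real_derivative v_t {} t) (at t within {tlo..thi})"
    by (rule has_field_derivative_transform_within[OF v_deriv[OF empty_bundle t] zero_less_one t])
      (simp add: v_empty)
  then show ?thesis
    using vector_derivative_unique_within_closed_interval[of tlo thi t "\<lambda>_. 0" "v_t {} t" 0] types t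
    by (simp add: has_real_derivative_iff_has_vector_derivative)
qed

lemma phi_empty: "t \<in> {tlo..thi} \<Longrightarrow> phi {} t = 0"
  by (simp add: phi_def v_empty v_t_empty)

lemma measurable_on_types: "borel_measurable (restrict_space lborel {tlo..thi}) =
    (borel_measurable (restrict_space borel {tlo..thi}) :: (real \<Rightarrow> real) set)"
  by (intro measurable_cong_sets sets_restrict_space_cong) auto

lemma continuous_on_types_measurable:
  fixes g :: "real \<Rightarrow> real"
  shows "continuous_on {tlo..thi} g \<Longrightarrow> g \<in> borel_measurable (restrict_space borel {tlo..thi})"
  by (rule borel_measurable_continuous_on_restrict)

lemma continuous_on_types_bounded:
  fixes g :: "real \<Rightarrow> real"
  assumes "continuous_on {tlo..thi} g"
  obtains M where "M > 0" "\<And>t. t \<in> {tlo..thi} \<Longrightarrow> \<bar>g t\<bar> \<le> M"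
proof -
  have "bounded (g ` {tlo..thi})"
    using assms by (intro compact_imp_bounded compact_continuous_image compact_Icc)
  then show ?thesis using that by (auto simp: bounded_pos)
qed

lemma density_times_set_integrable:
  assumes g: "g \<in> borel_measurable (restrict_space borel {tlo..thi})"
    and bd: "\<And>t. t \<in> {tlo..thi} \<Longrightarrow> \<bar>g t\<bar> \<le> M"
  shows "set_integrable lborel {tlo..thi} (\<lambda>t. f t * g t)"
proof -
  obtain C where C: "C > 0" "\<And>t. t \<in> {tlo..thi} \<Longrightarrow> \<bar>f t\<bar> \<le> C"
    using continuous_on_types_bounded[OF density_cont] by blast
  show ?thesis
  proof (rule bounded_measurable_set_integrable)
    show "(\<lambda>t. f t * g t) \<in> borel_measurable (restrict_space borel {tlo..thi})"
      using g continuous_on_types_measurable[OF density_cont] by simp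
    show "\<bar>f t * g t\<bar> \<le> C * M" if "t \<in> {tlo..thi}" for t
      using C bd[OF that] that by (auto simp: abs_mult intro!: mult_mono)
  qed
qed

text \<open>A bridge from expectations under the law of the type to gauge integrals over the
  interval, where the fundamental theorem of calculus and splitting of intervals apply. Boundedness
  supplies integrability.\<close>

lemma integral_type_law:
  assumes g: "g \<in> borel_measurable (restrict_space borel {tlo..thi})"
    and bd: "\<And>t. t \<in> {tlo..thi} \<Longrightarrow> \<bar>g t\<bar> \<le> M"
  shows "integral\<^sup>L (type_law tlo thi f) g = integral {tlo..thi} (\<lambda>t. f t * g t)"
proof -
  have "integral\<^sup>L (type_law tlo thi f) g
      = integral\<^sup>L (restrict_space lborel {tlo..thi}) (\<lambda>t. f t * g t)"
    unfolding type_law_def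
    using g continuous_on_types_measurable[OF density_cont] density_pos
    by (subst integral_density) (auto simp: measurable_on_types less_imp_le intro!: AE_I2)
  also have "\<dots> = (LINT t:{tlo..thi}|lborel. f t * g t)"
    by (subst integral_restrict_space) (auto simp: set_lebesgue_integral_def)
  also have "\<dots> = integral {tlo..thi} (\<lambda>t. f t * g t)"
    by (rule set_borel_integral_eq_integral(2)[OF density_times_set_integrable[OF g bd]])
  finally show ?thesis .
qed

lemma F_eq_integral:
  assumes t: "t \<in> {tlo..thi}"
  shows "F t = integral {tlo..t} f"
proof -
  interpret prob_space "type_law tlo thi f" by (rule density_prob)
  have [simp]: "{tlo..t} \<in> sets (restrict_space borel {tlo..thi})"
    using t by (auto simp: sets_restrict_space_iff)
  then have s: "{tlo..t} \<in> sets (type_law tlo thi f)"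
    by (simp add: type_law_def sets_restrict_space)
  have "F t = integral\<^sup>L (type_law tlo thi f) (indicator {tlo..t})"
    using s by (simp add: F_def emeasure_eq_measure)
  also have "\<dots> = integral {tlo..thi} (\<lambda>s. f s * indicator {tlo..t} s)"
    by (rule integral_type_law[where M = 1]) (auto intro!: borel_measurable_indicator split: split_indicator)
  also have "\<dots> = integral {tlo..thi} (\<lambda>s. if s \<in> {tlo..t} then f s else 0)"
    by (intro integral_cong) (simp add: indicator_def)
  also have "\<dots> = integral ({tlo..t} \<inter> {tlo..thi}) f"
    by (rule integral_restrict_Int)
  also have "{tlo..t} \<inter> {tlo..thi} = {tlo..t}" using t by auto
  finally show ?thesis .
qed

lemma F_thi: "F thi = 1"
proof -
  interpret prob_space "type_law tlo thi f" by (rule density_prob)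
  have "space (type_law tlo thi f) = {tlo..thi}"
    by (simp add: type_law_def space_restrict_space)
  then show ?thesis using prob_space by (simp add: F_def)
qed

lemma F_tlo: "F tlo = 0"
  using types by (simp add: F_eq_integral)

lemma F_deriv:
  assumes t: "t \<in> {tlo..thi}"
  shows "(F has_real_derivative f t) (at t within {tlo..thi})"
  by (rule has_field_derivative_transform_within[OF
        integral_has_real_derivative[OF density_cont t] zero_less_one t])
    (simp add: F_eq_integral)

lemma F_cont: "continuous_on {tlo..thi} F"
  by (rule DERIV_continuous_on[OF F_deriv])

lemma F_strict_mono:
  assumes "s \<in> {tlo..thi}" "t \<in> {tlo..thi}" "s < t"
  shows "F s < F t"
proof (rule DERIV_pos_imp_increasing_open[OF \<open>s < t\<close>])
  show "\<exists>y. (F has_real_derivative y) (at x) \<and> 0 < y" if "s < x" "x < t" for x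
    using F_deriv[of x] density_pos[of x] assms that
    by (intro exI[of _ "f x"]) (auto simp: at_within_Icc_at)
  show "continuous_on {s..t} F"
    by (rule continuous_on_subset[OF F_cont]) (use assms in auto)
qed

lemma F_bounds:
  assumes t: "t \<in> {tlo..thi}"
  shows "0 \<le> F t" "F t \<le> 1"
  using F_strict_mono[of tlo t] F_strict_mono[of t thi] t types F_tlo F_thi
  by (auto simp: less_le) (smt (verit))+

lemma phi_cont: "b \<in> bundles n \<Longrightarrow> continuous_on {tlo..thi} (phi b)"
  unfolding phi_def using density_pos
  by (intro continuous_intros v_cont F_cont density_cont v_deriv_cont) (auto simp: less_imp_neq[THEN not_sym])

lemma phi_thi: "phi b thi = v b thi"
  by (simp add: phi_def F_thi)

text \<open>The right-hand side is the derivative of \<open>- ((1 - F t) * v b t)\<close>; this is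
  what makes virtual values integrate to revenue.\<close>

lemma density_times_phi: "t \<in> {tlo..thi} \<Longrightarrow> f t * phi b t = f t * v b t - (1 - F t) * v_t b t"
  using density_pos[of t] by (simp add: phi_def field_simps)

text \<open>The mean value theorem gives the slope at an intermediate point, and uniform continuity
  of \<open>v_t b\<close> moves it to \<open>t\<close>. The threshold for \<open>h\<close> is
  uniform in \<open>t\<close> and, by finiteness, in \<open>b\<close>; this matters because an
  allocation may vary arbitrarily with the type.\<close>

lemma v_increment:
  assumes e: "e > 0"
  shows "\<forall>\<^sub>F h in at_right 0. \<forall>b\<in>bundles n. \<forall>t. tlo \<le> t \<and> t + h \<le> thi \<longrightarrow>
           h * (v_t b t - e) \<le> v b (t + h) - v b t"
proof (intro eventually_ball_finite finite_bundles ballI)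
  fix b assume b: "b \<in> bundles n"
  from uniformly_continuous_eventually_at_right[OF v_deriv_cont[OF b] e] eventually_at_right_less
  show "\<forall>\<^sub>F h in at_right 0. \<forall>t. tlo \<le> t \<and> t + h \<le> thi \<longrightarrow>
           h * (v_t b t - e) \<le> v b (t + h) - v b t"
  proof eventually_elim
    case (elim h)
    show ?case
    proof (intro allI impI)
      fix t assume t: "tlo \<le> t \<and> t + h \<le> thi"
      have "\<exists>z\<in>{t<..<t + h}. v b (t + h) - v b t = v_t b z * (t + h - t)"
        using elim(2)
      proof (intro mvt_simple)
        show "(v b has_derivative (*) (v_t b z)) (at z within {t..t + h})"
          if "t \<le> z" "z \<le> t + h" for z
          using v_deriv[OF b, of z] t that elim(2)
          by (auto simp: has_field_derivative_def intro: has_derivative_subset)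
      qed auto
      then obtain z where z: "z \<in> {t<..<t + h}" "v b (t + h) - v b t = h * v_t b z"
        by (auto simp: mult.commute)
      have "\<bar>v_t b z - v_t b t\<bar> \<le> e"
        using elim(1) z(1) t by auto
      then show "h * (v_t b t - e) \<le> v b (t + h) - v b t"
        using elim(2) by (simp add: z(2))
    qed
  qed
qed

lemma stoch_ext_eq_sum:
  "a \<in> stoch_bundles n \<Longrightarrow> stoch_ext g a t = (\<Sum>b\<in>bundles n. pmf a b * g b t)"
  unfolding stoch_ext_def
  by (subst integral_measure_pmf[OF finite_bundles]) (auto simp: stoch_bundles_def)

lemma sum_pmf_bundles: "a \<in> stoch_bundles n \<Longrightarrow> (\<Sum>b\<in>bundles n. pmf a b) = 1"
  by (rule sum_pmf_eq_1[OF finite_bundles]) (simp add: stoch_bundles_def)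

lemma stoch_ext_return [simp]: "stoch_ext g (return_pmf b) t = g b t"
  by (simp add: stoch_ext_def)

lemma stoch_ext_mono:
  assumes "a \<in> stoch_bundles n" "\<And>b. b \<in> bundles n \<Longrightarrow> g b t \<le> g' b t'"
  shows "stoch_ext g a t \<le> stoch_ext g' a t'"
  using assms by (auto simp: stoch_ext_eq_sum intro!: sum_mono mult_left_mono)

text \<open>Every probability is at most 1. The resulting bound does not mention \<open>a\<close>,
  so it gives estimates uniform over all allocations.\<close>

lemma abs_stoch_ext_le:
  assumes "a \<in> stoch_bundles n"
  shows "\<bar>stoch_ext g a t\<bar> \<le> (\<Sum>b\<in>bundles n. \<bar>g b t\<bar>)"
proof -
  have "\<bar>stoch_ext g a t\<bar> \<le> (\<Sum>b\<in>bundles n. \<bar>pmf a b * g b t\<bar>)"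
    using assms by (simp add: stoch_ext_eq_sum)
  also have "\<dots> \<le> (\<Sum>b\<in>bundles n. \<bar>g b t\<bar>)"
    by (intro sum_mono) (simp add: abs_mult mult_left_le_one_le pmf_le_1)
  finally show ?thesis .
qed

end

section \<open>Measurability and boundedness of quantities evaluated along a mechanism\<close>

context monopolist
begin

lemma mechanism_stoch_ext_measurable:
  assumes a: "mechanism a p" and g: "\<And>b. b \<in> bundles n \<Longrightarrow> continuous_on {tlo..thi} (g b)"
  shows "(\<lambda>t. stoch_ext g (a t) t) \<in> borel_measurable (restrict_space borel {tlo..thi})"
proof -
  have "(\<lambda>t. \<Sum>b\<in>bundles n. pmf (a t) b * g b t) \<in> borel_measurable (restrict_space borel {tlo..thi})"
  proof (intro borel_measurable_sum borel_measurable_times)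
    fix b assume b: "b \<in> bundles n"
    show "(\<lambda>t. pmf (a t) b) \<in> borel_measurable (restrict_space borel {tlo..thi})"
      using a b by (simp add: mechanism_def)
    show "g b \<in> borel_measurable (restrict_space borel {tlo..thi})"
      by (rule continuous_on_types_measurable[OF g[OF b]])
  qed
  then show ?thesis
    using a by (subst measurable_cong[where g = "\<lambda>t. \<Sum>b\<in>bundles n. pmf (a t) b * g b t"])
      (auto simp: mechanism_def space_restrict_space stoch_ext_eq_sum)
qed

lemma mechanism_stoch_ext_bounded:
  assumes a: "mechanism a p" and g: "\<And>b. b \<in> bundles n \<Longrightarrow> continuous_on {tlo..thi} (g b)"
  obtains M where "\<And>t. t \<in> {tlo..thi} \<Longrightarrow> \<bar>stoch_ext g (a t) t\<bar> \<le> M"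
proof -
  have "continuous_on {tlo..thi} (\<lambda>t. \<Sum>b\<in>bundles n. \<bar>g b t\<bar>)"
    by (intro continuous_intros g)
  then obtain M where M: "\<And>t. t \<in> {tlo..thi} \<Longrightarrow> \<bar>\<Sum>b\<in>bundles n. \<bar>g b t\<bar>\<bar> \<le> M"
    using continuous_on_types_bounded by blast
  have "\<bar>stoch_ext g (a t) t\<bar> \<le> M" if t: "t \<in> {tlo..thi}" for t
    using abs_stoch_ext_le[of "a t" g t] M[OF t] a t by (auto simp: mechanism_def)
  then show ?thesis using that by blast
qed

section \<open>The virtual surplus as an upper bound on revenue\<close>

text \<open>Only one half of the envelope theorem is needed: IC bounds the increments of the indirect utility
  \<open>U\<close> from below, which turns into the lower bound \<open>(1 - F) v\<^sub>t\<close> on the increments of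
  \<open>J x\<close>, where \<open>J thi - J tlo\<close> is \<open>\<integral> f U\<close> minus the utility of the lowest type.\<close>

lemma revenue_le_virtual_surplus:
  assumes feas: "feasible a p"
  shows "revenue p \<le> integral {tlo..thi} (\<lambda>t. f t * stoch_ext phi (a t) t)"
proof -
  define T where "T = {tlo..thi}"
  \<comment> \<open>\<open>V s t\<close> is the value of type \<open>t\<close> for the allocation of
    type \<open>s\<close>; \<open>w t\<close> is the slope of \<open>V t\<close> at the true type
    \<open>t\<close>.\<close>
  define V where "V s t = stoch_ext v (a s) t" for s t
  define U where "U t = V t t - p t" for t
  define w where "w t = stoch_ext v_t (a t) t" for t
  define J where "J x = (1 - F x) * U x + integral {tlo..x} (\<lambda>t. f t * U t)" for x
  have mech: "mechanism a p" and ic: "IC a p" and ir: "IR a p"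
    using feas by (auto simp: feasible_def)
  have aT: "a t \<in> stoch_bundles n" if "t \<in> T" for t
    using mech that by (auto simp: mechanism_def T_def)
  have U_diff: "V s t - V s s \<le> U t - U s" if "s \<in> T" "t \<in> T" for s t
  proof -
    have "stoch_ext v (a s) t - p s \<le> stoch_ext v (a t) t - p t"
      using ic that unfolding IC_def T_def by blast
    then show ?thesis by (simp add: U_def V_def)
  qed
  \<comment> \<open>The difference is the expectation of a function that ignores its type argument;
    the 0 is a dummy. This makes the general bounds on \<open>stoch_ext\<close> applicable.\<close>
  have V_diff: "V s t - V s r = stoch_ext (\<lambda>b _. v b t - v b r) (a s) 0" if "s \<in> T" for s t r
    unfolding V_def stoch_ext_eq_sum[OF aT[OF that]]
    by (simp add: sum_subtractf[symmetric] right_diff_distrib)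
  have V_diff_abs: "\<bar>V s t - V s r\<bar> \<le> (\<Sum>b\<in>bundles n. \<bar>v b t - v b r\<bar>)" if "s \<in> T" for s t r
    unfolding V_diff[OF that] by (rule abs_stoch_ext_le[OF aT[OF that]])
  \<comment> \<open>IC applied in both directions squeezes the change of \<open>U\<close> between
    two value changes, which yields continuity of \<open>U\<close> without any regularity of the
    allocation.\<close>
  have U_abs: "\<bar>U t - U s\<bar> \<le> (\<Sum>b\<in>bundles n. \<bar>v b t - v b s\<bar>)" if "s \<in> T" "t \<in> T" for s t
    using U_diff[OF that] U_diff[OF that(2,1)] V_diff_abs[OF that(1), of t s]
      V_diff_abs[OF that(2), of t s] by linarith
  have U_cont: "continuous_on T U"
    unfolding continuous_on_def
  proof
    fix s assume s: "s \<in> T"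
    have "((\<lambda>t. \<Sum>b\<in>bundles n. \<bar>v b t - v b s\<bar>) \<longlongrightarrow> (\<Sum>b\<in>bundles n. \<bar>v b s - v b s\<bar>)) (at s within T)"
      using s v_cont by (intro tendsto_intros) (auto simp: continuous_on_def T_def)
    then have "((\<lambda>t. \<Sum>b\<in>bundles n. \<bar>v b t - v b s\<bar>) \<longlongrightarrow> 0) (at s within T)"
      by simp
    moreover have "\<forall>\<^sub>F t in at s within T. norm (U t - U s) \<le> (\<Sum>b\<in>bundles n. \<bar>v b t - v b s\<bar>)"
      unfolding eventually_at_filter real_norm_def using U_abs[OF s] by (intro always_eventually) blast
    ultimately have "((\<lambda>t. U t - U s) \<longlongrightarrow> 0) (at s within T)"
      by (rule Lim_null_comparison[rotated])
    then show "(U \<longlongrightarrow> U s) (at s within T)" by (rule LIM_zero_cancel)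
  qed
  obtain CU where CU: "\<And>t. t \<in> T \<Longrightarrow> \<bar>U t\<bar> \<le> CU"
    using continuous_on_types_bounded[of U] U_cont unfolding T_def by blast
  obtain CV where CV: "\<And>t. t \<in> T \<Longrightarrow> \<bar>V t t\<bar> \<le> CV"
    using mechanism_stoch_ext_bounded[where g = v, OF mech v_cont] unfolding T_def V_def by blast
  obtain Cw where Cw: "\<And>t. t \<in> T \<Longrightarrow> \<bar>w t\<bar> \<le> Cw"
    using mechanism_stoch_ext_bounded[where g = v_t, OF mech v_deriv_cont] unfolding T_def w_def by blast
  obtain M where M: "M > 0" "\<And>t. t \<in> T \<Longrightarrow> \<bar>f t\<bar> \<le> M"
    using continuous_on_types_bounded[OF density_cont] unfolding T_def by blast
  have fU_cont: "continuous_on T (\<lambda>t. f t * U t)"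
    using density_cont U_cont by (auto simp: T_def intro!: continuous_intros)
  have fU: "(\<lambda>t. f t * U t) integrable_on {x..y}" if "{x..y} \<subseteq> T" for x y
    by (intro integrable_continuous_real continuous_on_subset[OF fU_cont] that)
  have fV: "(\<lambda>t. f t * V t t) integrable_on T"
    using density_times_set_integrable[of "\<lambda>t. V t t" CV] CV mechanism_stoch_ext_measurable[where g = v, OF mech v_cont]
    unfolding T_def V_def by (intro set_borel_integral_eq_integral(1)) auto
  have Gw: "(\<lambda>t. (1 - F t) * w t) integrable_on T"
    unfolding T_def
  proof (rule set_borel_integral_eq_integral(1)[OF bounded_measurable_set_integrable])
    show "(\<lambda>t. (1 - F t) * w t) \<in> borel_measurable (restrict_space borel {tlo..thi})"
    proof (rule borel_measurable_times)
      show "(\<lambda>t. 1 - F t) \<in> borel_measurable (restrict_space borel {tlo..thi})"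
        by (intro continuous_on_types_measurable continuous_intros F_cont)
      show "w \<in> borel_measurable (restrict_space borel {tlo..thi})"
        unfolding w_def[abs_def] by (rule mechanism_stoch_ext_measurable[OF mech v_deriv_cont])
    qed
    show "\<bar>(1 - F t) * w t\<bar> \<le> 1 * Cw" if "t \<in> {tlo..thi}" for t
      unfolding abs_mult using F_bounds[OF that] Cw[of t] that by (intro mult_mono) (auto simp: T_def)
  qed
  \<comment> \<open>This is the hypothesis of \<open>integral_le_increment\<close> for
    \<open>J\<close>. Half of the error \<open>e\<close> pays for the linearization of
    \<open>v\<close>, the other half for replacing \<open>U r\<close> by \<open>U (t + h)\<close>
    under the density, whose bound \<open>M\<close> explains \<open>e / (2 * M)\<close>.\<close>
  have J_inc: "\<forall>\<^sub>F h in at_right 0. \<forall>t. tlo \<le> t \<and> t + h \<le> thi \<longrightarrow>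
                h * ((1 - F t) * w t - e) \<le> J (t + h) - J t" if e: "e > 0" for e
  proof -
    have e2: "e / 2 > 0" and eM: "e / (2 * M) > 0" using e M(1) by auto
    from v_increment[OF e2] uniformly_continuous_eventually_at_right[OF U_cont[unfolded T_def] eM]
      eventually_at_right_less
    show ?thesis
    proof eventually_elim
      case (elim h)
      show ?case
      proof (intro allI impI)
        fix t assume t: "tlo \<le> t \<and> t + h \<le> thi"
        have tT: "t \<in> T" "t + h \<in> T" and sub: "{t..t + h} \<subseteq> T"
          using t elim(3) by (auto simp: T_def)
        have f_int: "f integrable_on {t..t + h}"
          using sub by (intro integrable_continuous_real continuous_on_subset[OF density_cont])
            (auto simp: T_def)
        have "stoch_ext (\<lambda>b _. h * (v_t b t - e / 2)) (a t) 0
            = (\<Sum>b\<in>bundles n. h * (pmf (a t) b * v_t b t) - h * (e / 2) * pmf (a t) b)"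
          unfolding stoch_ext_eq_sum[OF aT[OF tT(1)]] by (intro sum.cong) (auto simp: algebra_simps)
        also have "\<dots> = h * (w t - e / 2)"
          unfolding w_def stoch_ext_eq_sum[OF aT[OF tT(1)]] sum_subtractf
            sum_distrib_left[symmetric] sum_pmf_bundles[OF aT[OF tT(1)]]
          by (simp add: right_diff_distrib)
        finally have "h * (w t - e / 2) = stoch_ext (\<lambda>b _. h * (v_t b t - e / 2)) (a t) 0" ..
        also have "\<dots> \<le> V t (t + h) - V t t"
          unfolding V_diff[OF tT(1)] using elim(1) t by (intro stoch_ext_mono aT tT) auto
        also have "\<dots> \<le> U (t + h) - U t" by (rule U_diff[OF tT])
        finally have "(1 - F t) * (h * (w t - e / 2)) \<le> (1 - F t) * (U (t + h) - U t)"
          using F_bounds(2)[of t] tT by (intro mult_left_mono) (auto simp: T_def)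
        moreover have "F t * (h * (e / 2)) \<ge> 0"
          using F_bounds(1)[of t] tT e elim(3) by (auto simp: T_def)
        moreover have "(1 - x) * (h * (y - z)) = h * ((1 - x) * y) - h * z + x * (h * z)" for x y z
          by (simp add: algebra_simps)
        note this[of "F t" "w t" "e / 2"]
        ultimately have 1: "h * ((1 - F t) * w t) - h * (e / 2) \<le> (1 - F t) * (U (t + h) - U t)"
          by linarith
        have "integral {t..t + h} (\<lambda>_. - (e / 2)) \<le> integral {t..t + h} (\<lambda>r. f r * U r - f r * U (t + h))"
        proof (rule integral_le)
          show "(\<lambda>r. f r * U r - f r * U (t + h)) integrable_on {t..t + h}"
            by (intro integrable_diff fU sub integrable_on_mult_left f_int)
          fix r assume r: "r \<in> {t..t + h}"
          have "\<bar>U r - U (t + h)\<bar> \<le> e / (2 * M)"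
            using elim(2) r sub tT by (auto simp: T_def)
          then have "\<bar>f r * (U r - U (t + h))\<bar> \<le> M * (e / (2 * M))"
            unfolding abs_mult using M r sub by (intro mult_mono) auto
          then have "\<bar>f r * U r - f r * U (t + h)\<bar> \<le> e / 2"
            using M(1) by (simp add: right_diff_distrib)
          then show "- (e / 2) \<le> f r * U r - f r * U (t + h)"
            by linarith
        qed auto
        then have 2: "- (h * (e / 2)) \<le> integral {t..t + h} (\<lambda>r. f r * U r) - integral {t..t + h} f * U (t + h)"
          using elim(3) by (simp add: Henstock_Kurzweil_Integration.integral_diff fU sub f_int integrable_on_mult_left)
        have 3: "integral {t..t + h} f = F (t + h) - F t"
          using Henstock_Kurzweil_Integration.integral_combine[of tlo t "t + h" f] t elim(3) tT
          by (simp add: F_eq_integral T_def integrable_continuous_real continuous_on_subset[OF density_cont])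
        have 4: "integral {t..t + h} (\<lambda>r. f r * U r)
            = integral {tlo..t + h} (\<lambda>r. f r * U r) - integral {tlo..t} (\<lambda>r. f r * U r)"
          using Henstock_Kurzweil_Integration.integral_combine[of tlo t "t + h" "\<lambda>r. f r * U r"] t elim(3)
            fU[of tlo "t + h"] by (auto simp: T_def)
        \<comment> \<open>A discrete product rule for \<open>(1 - F) * U\<close>: the increment of
          \<open>F\<close> is paired with \<open>U (t + h)\<close>, and by \<open>3\<close> it
          equals the integral of \<open>f\<close>, so it can be compared with the integral of
          \<open>f * U\<close>.\<close>
        have "J (t + h) - J t = (1 - F t) * (U (t + h) - U t)
            + (integral {t..t + h} (\<lambda>r. f r * U r) - integral {t..t + h} f * U (t + h))"
          unfolding J_def 3 4 by (simp add: algebra_simps)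
        moreover have "h * ((1 - F t) * w t - e) = h * ((1 - F t) * w t) - h * (e / 2) - h * (e / 2)"
          by (simp add: right_diff_distrib)
        ultimately show "h * ((1 - F t) * w t - e) \<le> J (t + h) - J t"
          using 1 2 by linarith
      qed
    qed
  qed
  have "integral T (\<lambda>t. (1 - F t) * w t) \<le> J thi - J tlo"
    unfolding T_def
  proof (rule integral_le_increment[OF types])
    show "continuous_on {tlo..thi} J"
      unfolding J_def using U_cont fU[of tlo thi]
      by (intro continuous_intros F_cont indefinite_integral_continuous_1) (auto simp: T_def)
  qed (use Gw J_inc in \<open>auto simp: T_def\<close>)
  also have "\<dots> = integral T (\<lambda>t. f t * U t) - U tlo"
    by (simp add: J_def F_thi F_tlo T_def)
  \<comment> \<open>IR for the lowest type makes \<open>U tlo\<close> nonnegative.\<close>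
  also have "\<dots> \<le> integral T (\<lambda>t. f t * U t)"
    using ir types by (simp add: IR_def U_def V_def)
  finally have *: "integral T (\<lambda>t. (1 - F t) * w t) \<le> integral T (\<lambda>t. f t * U t)" .
  have "revenue p = integral T (\<lambda>t. f t * p t)"
    unfolding revenue_def T_def
  proof (rule integral_type_law)
    show "\<bar>p t\<bar> \<le> CV + CU" if "t \<in> {tlo..thi}" for t
      using CU[of t] CV[of t] that by (simp add: U_def T_def abs_le_iff)
  qed (use mech in \<open>simp add: mechanism_def\<close>)
  also have "\<dots> = integral T (\<lambda>t. f t * V t t - f t * U t)"
    by (simp add: U_def right_diff_distrib)
  also have "\<dots> = integral T (\<lambda>t. f t * V t t) - integral T (\<lambda>t. f t * U t)"
    using fU[of tlo thi] by (intro Henstock_Kurzweil_Integration.integral_diff fV) (auto simp: T_def)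
  also have "\<dots> \<le> integral T (\<lambda>t. f t * V t t) - integral T (\<lambda>t. (1 - F t) * w t)"
    using * by simp
  also have "\<dots> = integral T (\<lambda>t. f t * V t t - (1 - F t) * w t)"
    by (rule Henstock_Kurzweil_Integration.integral_diff[OF fV Gw, symmetric])
  \<comment> \<open>The integrands agree type by type: this is \<open>density_times_phi\<close>
    averaged over the distribution \<open>a t\<close>.\<close>
  also have "\<dots> = integral T (\<lambda>t. f t * stoch_ext phi (a t) t)"
  proof (rule integral_cong)
    fix t assume t: "t \<in> T"
    have "f t * V t t - (1 - F t) * w t
        = (\<Sum>b\<in>bundles n. pmf (a t) b * (f t * v b t - (1 - F t) * v_t b t))"
      by (simp add: V_def w_def stoch_ext_eq_sum[OF aT[OF t]] sum_distrib_left
          right_diff_distrib sum_subtractf mult.left_commute)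
    also have "\<dots> = (\<Sum>b\<in>bundles n. pmf (a t) b * (f t * phi b t))"
      using t by (simp add: density_times_phi T_def)
    also have "\<dots> = f t * stoch_ext phi (a t) t"
      by (simp add: stoch_ext_eq_sum[OF aT[OF t]] sum_distrib_left mult.left_commute)
    finally show "f t * V t t - (1 - F t) * w t = f t * stoch_ext phi (a t) t" .
  qed
  finally show ?thesis by (simp add: T_def)
qed

section \<open>Signs of a virtual value on either side of its unique zero, and their
  consequences\<close>

definition phi_zero :: "nat set \<Rightarrow> real" where
  "phi_zero b = (THE t. t \<in> {tlo..thi} \<and> phi b t = 0)"

lemma
  assumes b: "b \<in> bundles n" "b \<noteq> {}"
  shows phi_zero_mem: "phi_zero b \<in> {tlo..thi}" and phi_at_zero: "phi b (phi_zero b) = 0"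
  using theI'[OF phi_zero_unique[OF b]] by (auto simp: phi_zero_def)

lemma phi_eq_0_imp:
  assumes "b \<in> bundles n" "b \<noteq> {}" "t \<in> {tlo..thi}" "phi b t = 0"
  shows "t = phi_zero b"
  using phi_zero_unique[of b] phi_zero_mem[of b] phi_at_zero[of b] assms by blast

lemma phi_tlo_neg:
  assumes b: "b \<in> bundles n" "b \<noteq> {}"
  shows "phi b tlo < 0"
  using phi_bottom(1) b finite_bundles by (subst (asm) Max_less_iff) auto

text \<open>The virtual value starts out negative at \<open>tlo\<close>, so a nonnegative value at
  \<open>t\<close> would force a second zero at or before \<open>t\<close> by the intermediate value
  theorem.\<close>

lemma phi_neg:
  assumes b: "b \<in> bundles n" "b \<noteq> {}" and t: "t \<in> {tlo..thi}" "t < phi_zero b"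
  shows "phi b t < 0"
proof (rule ccontr)
  assume "\<not> phi b t < 0"
  then obtain s where s: "tlo \<le> s" "s \<le> t" "phi b s = 0"
    using phi_tlo_neg[OF b] t IVT'[of "phi b" tlo 0 t] continuous_on_subset[OF phi_cont[OF b(1)]]
    by auto
  then have "s = phi_zero b"
    using phi_eq_0_imp[OF b, of s] t by simp
  then show False using s t by simp
qed

text \<open>Mirror image of \<open>phi_neg\<close>, starting from the top type, where the virtual
  value equals the positive value.\<close>

lemma phi_pos:
  assumes b: "b \<in> bundles n" "b \<noteq> {}" and t: "t \<in> {tlo..thi}" "phi_zero b < t"
  shows "phi b t > 0"
proof (rule ccontr)
  assume "\<not> phi b t > 0"
  then obtain s where s: "t \<le> s" "s \<le> thi" "phi b s = 0"
    using v_top_pos[OF b] t IVT'[of "phi b" t 0 thi] continuous_on_subset[OF phi_cont[OF b(1)]]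
    by (auto simp: phi_thi)
  then have "s = phi_zero b"
    using phi_eq_0_imp[OF b, of s] t by simp
  then show False using s t by simp
qed

lemma phi_zero_less:
  assumes b: "b \<in> bundles n" "b \<noteq> {}"
  shows "tlo < phi_zero b" "phi_zero b < thi"
  using phi_zero_mem[OF b] phi_at_zero[OF b] phi_tlo_neg[OF b] v_top_pos[OF b]
  by (auto simp: less_le phi_thi[symmetric])

lemma Q_le_imp_phi_zero_le:
  assumes b: "b \<in> bundles n" "b \<noteq> {}" and c: "c \<in> bundles n" "c \<noteq> {}" and Q: "Q c \<le> Q b"
  shows "phi_zero b \<le> phi_zero c"
proof -
  have "F (phi_zero b) \<le> F (phi_zero c)"
    using Q b c by (simp add: Q_def phi_zero_def)
  then show ?thesis
    using F_strict_mono[OF phi_zero_mem[OF c] phi_zero_mem[OF b]] by linarith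
qed

text \<open>Comparison with the empty bundle leaves only increasing or decreasing. If
  \<open>v b\<close> were decreasing, its slope at \<open>tlo\<close> would be nonpositive, so
  \<open>v b tlo\<close> would be at most the negative \<open>phi b tlo\<close>, and
  \<open>v b thi\<close> would be negative too, contradicting its positivity.\<close>

lemma value_mono_of_A1:
  assumes A1 and b: "b \<in> bundles n" "b \<noteq> {}"
  shows "mono_on {tlo..thi} (v b)"
proof (rule ccontr)
  assume "\<not> mono_on {tlo..thi} (v b)"
  moreover have "monotonic_on {tlo..thi} (\<lambda>t. v b t - v {} t)"
    using \<open>A1\<close> b empty_bundle by (auto simp: A1_def)
  ultimately have anti: "antimono_on {tlo..thi} (v b)"
    by (auto simp: monotonic_on_def monotone_on_def v_empty)
  have "v_t b tlo \<le> 0"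
  proof -
    have "((\<lambda>t. (v b t - v b tlo) / (t - tlo)) \<longlongrightarrow> v_t b tlo) (at_right tlo)"
      using v_deriv[OF b(1), of tlo] types by (simp add: has_field_derivative_iff at_within_Icc_at_right)
    moreover have "\<forall>\<^sub>F t in at_right tlo. (v b t - v b tlo) / (t - tlo) \<le> 0"
      using types monotone_onD[OF anti, of tlo]
      by (auto simp: eventually_at_right_field divide_le_0_iff intro!: exI[of _ thi])
    ultimately show ?thesis by (rule tendsto_upperbound) simp
  qed
  then have "v b tlo \<le> phi b tlo"
    using density_pos[of tlo] types by (simp add: phi_def F_tlo field_simps)
  moreover have "v b thi \<le> v b tlo"
    using monotone_onD[OF anti, of tlo thi] types by simp
  ultimately show False
    using phi_tlo_neg[OF b] v_top_pos[OF b] by simp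
qed

section \<open>Selling a single bundle at a posted price\<close>

definition posted_price_alloc :: "nat set \<Rightarrow> real \<Rightarrow> nat set pmf" where
  "posted_price_alloc b t = return_pmf (if phi_zero b \<le> t then b else {})"

definition posted_price_payment :: "nat set \<Rightarrow> real \<Rightarrow> real" where
  "posted_price_payment b t = (if phi_zero b \<le> t then v b (phi_zero b) else 0)"

text \<open>The price is the value of the threshold type. As \<open>v b\<close> is increasing, types
  above the threshold value the bundle at no less than the price and types below at no more, so
  nobody gains by switching sides.\<close>

lemma posted_price_feasible:
  assumes b: "b \<in> bundles n" "b \<noteq> {}" and mono: "mono_on {tlo..thi} (v b)"
  shows "feasible (posted_price_alloc b) (posted_price_payment b)"
  unfolding feasible_def
proof (intro conjI)
  have v_mono: "v b s \<le> v b t" if "s \<in> {tlo..thi}" "t \<in> {tlo..thi}" "s \<le> t" for s t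
    using monotone_onD[OF mono that] .
  have "(\<lambda>t. pmf (posted_price_alloc b t) c) \<in> borel_measurable (restrict_space borel {tlo..thi})" for c
    unfolding posted_price_alloc_def if_distrib[of return_pmf] if_distrib[of pmf] if_distribR
    by (intro measurable_restrict_space1) measurable
  moreover have "posted_price_payment b \<in> borel_measurable (restrict_space borel {tlo..thi})"
    unfolding posted_price_payment_def[abs_def] by (intro measurable_restrict_space1) measurable
  ultimately show "mechanism (posted_price_alloc b) (posted_price_payment b)"
    using b empty_bundle by (auto simp: mechanism_def posted_price_alloc_def stoch_bundles_def)
  show "IC (posted_price_alloc b) (posted_price_payment b)"
    using phi_zero_mem[OF b]
    by (auto simp: IC_def posted_price_alloc_def posted_price_payment_def v_empty intro!: v_mono)
  show "IR (posted_price_alloc b) (posted_price_payment b)"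
    using phi_zero_mem[OF b]
    by (auto simp: IR_def posted_price_alloc_def posted_price_payment_def v_empty intro!: v_mono)
qed

text \<open>The virtual surplus bound is tight here. Both sides equal
  \<open>(1 - F z) * v b z\<close> at the threshold \<open>z\<close>: the antiderivative
  \<open>- (1 - F) * v b\<close> of \<open>f * phi b\<close> vanishes at the top type.\<close>

lemma posted_price_revenue:
  assumes b: "b \<in> bundles n" "b \<noteq> {}"
  shows "revenue (posted_price_payment b)
       = integral {tlo..thi} (\<lambda>t. f t * stoch_ext phi (posted_price_alloc b t) t)"
proof -
  define z where "z = phi_zero b"
  have z: "z \<in> {tlo..thi}" unfolding z_def by (rule phi_zero_mem[OF b])
  \<comment> \<open>Payment and virtual surplus are both 0 below \<open>z\<close>, so both integrals
    reduce to \<open>{z..thi}\<close>.\<close>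
  have int: "integral {tlo..thi} (\<lambda>t. if t \<in> {z..thi} then g t else 0) = integral {z..thi} g"
    for g :: "real \<Rightarrow> real"
    unfolding integral_restrict_Int using z by (simp add: Int_absorb2)
  have "revenue (posted_price_payment b) = integral {tlo..thi} (\<lambda>t. f t * posted_price_payment b t)"
    unfolding revenue_def
  proof (rule integral_type_law)
    show "posted_price_payment b \<in> borel_measurable (restrict_space borel {tlo..thi})"
      unfolding posted_price_payment_def[abs_def] by (intro measurable_restrict_space1) measurable
  qed (auto simp: posted_price_payment_def)
  also have "\<dots> = integral {tlo..thi} (\<lambda>t. if t \<in> {z..thi} then f t * v b z else 0)"
    by (intro integral_cong) (auto simp: posted_price_payment_def z_def)
  also have "\<dots> = integral {z..thi} f * v b z"
    by (simp only: int) simp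
  also have "integral {z..thi} f = 1 - F z"
    using Henstock_Kurzweil_Integration.integral_combine[of tlo z thi f] z F_eq_integral[OF z]
      F_eq_integral[of thi] F_thi types by (simp add: integrable_continuous_real density_cont)
  also have "(1 - F z) * v b z = integral {z..thi} (\<lambda>t. f t * phi b t)"
  proof -
    have "((\<lambda>t. f t * phi b t) has_integral (- ((1 - F thi) * v b thi) - - ((1 - F z) * v b z))) {z..thi}"
    proof (rule fundamental_theorem_of_calculus)
      fix t assume t: "t \<in> {z..thi}"
      then have tT: "t \<in> {tlo..thi}" using z by auto
      have "((\<lambda>t. - ((1 - F t) * v b t)) has_real_derivative f t * phi b t) (at t within {tlo..thi})"
        using density_times_phi[OF tT]
        by (auto intro!: derivative_eq_intros F_deriv[OF tT] v_deriv[OF b(1) tT])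
      then have "((\<lambda>t. - ((1 - F t) * v b t)) has_real_derivative f t * phi b t) (at t within {z..thi})"
        by (rule DERIV_subset) (use z in auto)
      then show "((\<lambda>t. - ((1 - F t) * v b t)) has_vector_derivative f t * phi b t) (at t within {z..thi})"
        by (simp add: has_real_derivative_iff_has_vector_derivative)
    qed (use z in auto)
    then show ?thesis by (simp add: F_thi integral_unique)
  qed
  also have "\<dots> = integral {tlo..thi} (\<lambda>t. if t \<in> {z..thi} then f t * phi b t else 0)"
    by (simp only: int)
  also have "\<dots> = integral {tlo..thi} (\<lambda>t. f t * stoch_ext phi (posted_price_alloc b t) t)"
    by (intro integral_cong) (auto simp: posted_price_alloc_def z_def phi_empty)
  finally show ?thesis .
qed

lemma virtual_surplus_set_integrable:
  assumes "mechanism a p"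
  shows "set_integrable lborel {tlo..thi} (\<lambda>t. f t * stoch_ext phi (a t) t)"
proof -
  obtain M where M: "\<And>t. t \<in> {tlo..thi} \<Longrightarrow> \<bar>stoch_ext phi (a t) t\<bar> \<le> M"
    using mechanism_stoch_ext_bounded[where g = phi, OF assms phi_cont] by blast
  show ?thesis
    by (rule density_times_set_integrable[OF mechanism_stoch_ext_measurable[OF assms phi_cont] M])
qed

text \<open>At the zero of \<open>phi b\<close> the rival \<open>c\<close> has not yet become
  positive, because its own zero is no smaller; at the top type \<open>b\<close> is strictly ahead.
  Single crossing controls the sign of the difference in between.\<close>

lemma phi_dominance:
  assumes A1 and b: "b \<in> bundles n" "b \<noteq> {}" and c: "c \<in> bundles n" "c \<noteq> b"
    and top: "v c thi < v b thi" and Q: "Q c \<le> Q b"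
    and t: "t \<in> {tlo..thi}" "phi_zero b \<le> t"
  shows "phi c t \<le> phi b t"
proof (cases "c = {}")
  case True
  then show ?thesis
    using phi_pos[OF b t(1)] phi_at_zero[OF b] t by (cases "t = phi_zero b") (auto simp: phi_empty)
next
  case False
  define z where "z = phi_zero b"
  define g where "g s = sgn (phi b s - phi c s)" for s
  have z: "z \<in> {tlo..thi}" "z \<le> t" using phi_zero_mem[OF b] t by (auto simp: z_def)
  have "z \<le> phi_zero c"
    unfolding z_def by (rule Q_le_imp_phi_zero_le[OF b c(1) False Q])
  then have "phi c z \<le> 0"
    using phi_neg[OF c(1) False z(1)] phi_at_zero[OF c(1) False] by (cases "z = phi_zero c") auto
  then have g_z: "0 \<le> g z"
    using phi_at_zero[OF b] by (simp add: g_def z_def)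
  have g_thi: "g thi = 1"
    using top by (simp add: g_def phi_thi)
  have "monotonic_on {tlo..thi} g"
    using \<open>A1\<close> b(1) c(1) unfolding A1_def single_crossing_on_def g_def by blast
  \<comment> \<open>An increasing sign is bounded below by its value at \<open>z\<close>, a
    decreasing one by its value at \<open>thi\<close>; both are nonnegative.\<close>
  then have "0 \<le> g t"
    unfolding monotonic_on_def
  proof
    assume "mono_on {tlo..thi} g"
    then show ?thesis using g_z monotone_onD[of _ _ _ g z t] z t by fastforce
  next
    assume "antimono_on {tlo..thi} g"
    then show ?thesis using g_thi monotone_onD[of _ _ _ g t thi] t types by fastforce
  qed
  then show ?thesis by (simp add: g_def)
qed

section \<open>Optimality of the posted price for a dominant bundle, and the content of optimal
  menus\<close>

context
  fixes b :: "nat set"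
  assumes A1: A1 and b: "b \<in> bundles n" "b \<noteq> {}"
    and top: "\<And>c. c \<in> bundles n \<Longrightarrow> c \<noteq> b \<Longrightarrow> v c thi < v b thi"
    and Q: "\<And>c. c \<in> bundles n \<Longrightarrow> c \<noteq> b \<Longrightarrow> Q c \<le> Q b"
begin

lemma phi_below_neg:
  assumes "c \<in> bundles n" "c \<noteq> {}" "t \<in> {tlo..thi}" "t < phi_zero b"
  shows "phi c t < 0"
  using phi_neg[OF assms(1,2,3)] Q_le_imp_phi_zero_le[OF b assms(1,2)] Q[OF assms(1)] assms(4)
  by (cases "c = b") auto

lemma phi_le_posted_price:
  assumes c: "c \<in> bundles n" and t: "t \<in> {tlo..thi}"
  shows "phi c t \<le> stoch_ext phi (posted_price_alloc b t) t"
proof (cases "phi_zero b \<le> t")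
  case True
  then show ?thesis
    using phi_dominance[OF A1 b c _ top[OF c] Q[OF c] t] by (cases "c = b") (auto simp: posted_price_alloc_def)
next
  case False
  then show ?thesis
    using phi_below_neg[OF c _ t] t by (cases "c = {}") (auto simp: posted_price_alloc_def phi_empty)
qed

text \<open>Randomization cannot beat the best deterministic bundle: the virtual value of a lottery
  is an average of numbers below the same bound.\<close>

lemma stoch_phi_le_posted_price:
  assumes a: "a \<in> stoch_bundles n" and t: "t \<in> {tlo..thi}"
  shows "stoch_ext phi a t \<le> stoch_ext phi (posted_price_alloc b t) t"
proof -
  have "stoch_ext phi a t \<le> stoch_ext (\<lambda>_ _. stoch_ext phi (posted_price_alloc b t) t) a t"
    by (rule stoch_ext_mono[OF a]) (rule phi_le_posted_price[OF _ t])
  then show ?thesis by (simp add: stoch_ext_def[of "\<lambda>_ _. _"])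
qed

lemma posted_price_optimal: "optimal_mechanism (posted_price_alloc b) (posted_price_payment b)"
  unfolding optimal_mechanism_def
proof (intro conjI allI impI)
  show feas: "feasible (posted_price_alloc b) (posted_price_payment b)"
    by (rule posted_price_feasible[OF b value_mono_of_A1[OF A1 b]])
  fix a p assume ap: "feasible a p"
  have "revenue p \<le> integral {tlo..thi} (\<lambda>t. f t * stoch_ext phi (a t) t)"
    by (rule revenue_le_virtual_surplus[OF ap])
  also have "\<dots> \<le> integral {tlo..thi} (\<lambda>t. f t * stoch_ext phi (posted_price_alloc b t) t)"
  proof (rule integral_le)
    show "f t * stoch_ext phi (a t) t \<le> f t * stoch_ext phi (posted_price_alloc b t) t"
      if t: "t \<in> {tlo..thi}" for t
      using stoch_phi_le_posted_price[OF _ t] density_pos[OF t] ap t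
      by (auto simp: feasible_def mechanism_def)
  qed (use ap feas virtual_surplus_set_integrable set_borel_integral_eq_integral(1) in
      \<open>auto simp: feasible_def\<close>)
  also have "\<dots> = revenue (posted_price_payment b)"
    by (rule posted_price_revenue[OF b, symmetric])
  finally show "revenue p \<le> revenue (posted_price_payment b)" .
qed

text \<open>If the pointwise maximum were missed throughout the interval, the virtual surplus and
  hence the revenue would be strictly too small. Optimality says nothing about a single type, so
  what is extracted is some type in each open interval.\<close>

lemma optimal_mechanism_attains_posted_price:
  assumes opt: "optimal_mechanism a p" and cd: "c < d" "{c<..<d} \<subseteq> {tlo..thi}"
  obtains t where "t \<in> {c<..<d}"
    "stoch_ext phi (a t) t = stoch_ext phi (posted_price_alloc b t) t"
proof -
  have ap: "feasible a p" and feas: "feasible (posted_price_alloc b) (posted_price_payment b)"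
    using opt posted_price_optimal by (auto simp: optimal_mechanism_def)
  have le: "stoch_ext phi (a t) t \<le> stoch_ext phi (posted_price_alloc b t) t"
    if t: "t \<in> {tlo..thi}" for t
    using stoch_phi_le_posted_price[OF _ t] ap t by (auto simp: feasible_def mechanism_def)
  have "\<exists>t\<in>{c<..<d}. stoch_ext phi (a t) t = stoch_ext phi (posted_price_alloc b t) t"
  proof (rule ccontr)
    assume *: "\<not> ?thesis"
    have "revenue p \<le> integral {tlo..thi} (\<lambda>t. f t * stoch_ext phi (a t) t)"
      by (rule revenue_le_virtual_surplus[OF ap])
    also have "\<dots> < integral {tlo..thi} (\<lambda>t. f t * stoch_ext phi (posted_price_alloc b t) t)"
    proof (rule integral_strict_mono_set_integrable[OF _ _ _ _ cd])
      show "f t * stoch_ext phi (a t) t \<le> f t * stoch_ext phi (posted_price_alloc b t) t"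
        if t: "t \<in> {tlo..thi}" for t
        using le[OF t] density_pos[OF t] by auto
      show "f t * stoch_ext phi (a t) t < f t * stoch_ext phi (posted_price_alloc b t) t"
        if t: "t \<in> {c<..<d}" for t
        using le[of t] * t density_pos[of t] cd(2) by (fastforce simp: less_le)
    qed (use ap feas virtual_surplus_set_integrable in \<open>auto simp: feasible_def\<close>)
    also have "\<dots> = revenue (posted_price_payment b)"
      by (rule posted_price_revenue[OF b, symmetric])
    also have "\<dots> \<le> revenue p"
      using opt feas by (simp add: optimal_mechanism_def)
    finally show False by simp
  qed
  then show ?thesis using that by blast
qed

lemma posted_price_menu_optimal: "optimal_menu {{}, b}"
  unfolding optimal_menu_def
  using posted_price_optimal b empty_bundle
  by (auto simp: posted_price_alloc_def intro!: exI[of _ "posted_price_alloc b"])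

text \<open>Each of the two bundles is the unique maximizer of the virtual value on some open
  interval of types: the empty one below \<open>phi_zero b\<close>, and \<open>b\<close> just below
  the top type. An optimal deterministic allocation must therefore use both.\<close>

lemma optimal_menu_contains_posted_price:
  assumes B: "optimal_menu B"
  shows "{{}, b} \<subseteq> B"
proof -
  obtain a p where opt: "optimal_mechanism a p" and Bn: "B \<subseteq> bundles n"
    and aB: "\<And>t. t \<in> {tlo..thi} \<Longrightarrow> a t \<in> return_pmf ` B"
    using B by (auto simp: optimal_menu_def)
  have z: "tlo < phi_zero b" "phi_zero b < thi"
    by (rule phi_zero_less[OF b])+
  have "{} \<in> B"
  proof -
    obtain t where t: "t \<in> {tlo<..<phi_zero b}"
      and eq: "stoch_ext phi (a t) t = stoch_ext phi (posted_price_alloc b t) t"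
      by (rule optimal_mechanism_attains_posted_price[OF opt z(1)]) (use z in auto)
    have tT: "t \<in> {tlo..thi}" using t z by auto
    then obtain c where c: "c \<in> B" "a t = return_pmf c" using aB by auto
    have "phi c t = 0" using eq t tT by (simp add: c(2) posted_price_alloc_def phi_empty)
    then have "c = {}" using phi_below_neg[of c t] c(1) Bn t tT by force
    then show ?thesis using c(1) by simp
  qed
  moreover have "b \<in> B"
  proof -
    \<comment> \<open>The strict ranking of values at \<open>thi\<close> is a strict ranking of
      virtual values there; continuity and finiteness extend it to a left neighbourhood.\<close>
    have "\<forall>\<^sub>F t in at_left thi. \<forall>c\<in>bundles n - {b}. phi c t < phi b t"
    proof (intro eventually_ball_finite ballI)
      fix c assume c: "c \<in> bundles n - {b}"
      have "(phi c' \<longlongrightarrow> phi c' thi) (at_left thi)" if "c' \<in> bundles n" for c'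
        using phi_cont[OF that] types
        by (auto simp: continuous_on_def at_within_Icc_at_left dest: bspec[of _ _ thi])
      then have "((\<lambda>t. phi c t - phi b t) \<longlongrightarrow> phi c thi - phi b thi) (at_left thi)"
        using b c by (intro tendsto_diff) auto
      moreover have "phi c thi - phi b thi < 0" using top[of c] c by (simp add: phi_thi)
      ultimately have "\<forall>\<^sub>F t in at_left thi. phi c t - phi b t < 0" by (rule order_tendstoD(2))
      then show "\<forall>\<^sub>F t in at_left thi. phi c t < phi b t" by simp
    qed (use finite_bundles in auto)
    then obtain d where d: "d < thi"
      "\<And>t c. d < t \<Longrightarrow> t < thi \<Longrightarrow> c \<in> bundles n \<Longrightarrow> c \<noteq> b \<Longrightarrow> phi c t < phi b t"
      by (auto simp: eventually_at_left_field)
    \<comment> \<open>Above \<open>max d (phi_zero b)\<close> the posted price assigns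
      \<open>b\<close> and all rivals are strictly worse.\<close>
    obtain t where t: "t \<in> {max d (phi_zero b)<..<thi}"
      and eq: "stoch_ext phi (a t) t = stoch_ext phi (posted_price_alloc b t) t"
      by (rule optimal_mechanism_attains_posted_price[OF opt, of "max d (phi_zero b)" thi])
        (use z d in auto)
    have tT: "t \<in> {tlo..thi}" using t z by auto
    then obtain c where c: "c \<in> B" "a t = return_pmf c" using aB by auto
    have "phi c t = phi b t" using eq t by (simp add: c(2) posted_price_alloc_def)
    then have "c = b" using d(2)[of t c] c(1) Bn t by force
    then show ?thesis using c(1) by simp
  qed
  ultimately show ?thesis by simp
qed

text \<open>The menu is optimal and is contained in every optimal menu, so it is the least one; a
  minimal optimal menu cannot properly contain it.\<close>

lemma posted_price_menu_minimal_unique: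
  "minimal_optimal_menu {{}, b} \<and> (\<forall>B. minimal_optimal_menu B \<longrightarrow> B = {{}, b})"
proof (intro conjI allI impI)
  show "minimal_optimal_menu {{}, b}"
    unfolding minimal_optimal_menu_def
    using posted_price_menu_optimal optimal_menu_contains_posted_price by (blast dest: psubsetD)
  fix B assume B: "minimal_optimal_menu B"
  then have "{{}, b} \<subseteq> B"
    using optimal_menu_contains_posted_price by (simp add: minimal_optimal_menu_def)
  then show "B = {{}, b}"
    using B posted_price_menu_optimal unfolding minimal_optimal_menu_def psubset_eq by blast
qed

end

end

theorem theorem7:
  fixes n :: nat and tlo thi :: real and f :: "real \<Rightarrow> real"
    and v v_t :: "nat set \<Rightarrow> real \<Rightarrow> real"
  assumes "monopolist n tlo thi f v v_t"
    and "monopolist.A1 n tlo thi f v v_t"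
    and "monopolist.A2 n tlo thi f v v_t"
    and "{b. is_arg_max (\<lambda>b. v b thi) (\<lambda>b. b \<in> bundles n) b} = {{1..n}}"
    and "monopolist.Q tlo thi f v v_t {1..n} \<ge>
           Max (monopolist.Q tlo thi f v v_t ` (bundles n - {{1..n}}))"
  shows "monopolist.minimal_optimal_menu n tlo thi f v {{}, {1..n}} \<and>
    (\<forall>B. monopolist.minimal_optimal_menu n tlo thi f v B \<longrightarrow> B = {{}, {1..n}})"
proof -
  interpret monopolist n tlo thi f v v_t by (rule assms(1))
  have fin: "finite (bundles n - {{1..n}})" using finite_bundles by simp
  show ?thesis
  proof (rule posted_price_menu_minimal_unique[OF assms(2)])
    show "{1..n} \<in> bundles n" "{1..n} \<noteq> {}"
      using goods by (auto simp: bundles_def)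
    show "Q c \<le> Q {1..n}" if "c \<in> bundles n" "c \<noteq> {1..n}" for c
      using assms(5) that fin by (meson Max_ge finite_imageI image_eqI DiffI singletonD order_trans)
    show "v c thi < v {1..n} thi" if c: "c \<in> bundles n" "c \<noteq> {1..n}" for c
    proof -
      \<comment> \<open>Some bundle beats \<open>c\<close> at the top type, and no bundle beats the
        grand bundle, so the inequality is strict.\<close>
      have "is_arg_max (\<lambda>b. v b thi) (\<lambda>b. b \<in> bundles n) {1..n}"
        and "\<not> is_arg_max (\<lambda>b. v b thi) (\<lambda>b. b \<in> bundles n) c"
        using assms(4) c(2) by blast+
      then show ?thesis using c(1) by (force simp: is_arg_max_def)
    qed
  qed
qed

end
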